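(* Let $\Phi$ be the root system of type $A_n$ ($n\ge1$) and let $C$ be an arbitrary subset of $\Phi$, with associated quasitrivial magma structure $F_C$ on $\{1,2,\dots,n+1\}$. Then the index of $C$ is equal to the associativity index of $F_C$.
   Context: Root system of type $A_n$: $V$ is a real vector space with basis $\alpha_1,\dots,\alpha_n$, $\Phi=\{\pm(\alpha_i+\cdots+\alpha_k):1\le i\le k\le n\}$. For $1\le j\le k\le n$, $\alpha_{j,k+1}:=\alpha_j+\cdots+\alpha_k$. For a subset $C\subset\Phi$, $F_C:\{1,\dots,n+1\}^2\to\{1,\dots,n+1\}$ is the binary operation with $F_C(a,a)=a$ and, for $1\le j\le k\le n$: if $\pm\alpha_{j,k+1}\notin C$ then $F_C(j,k+1)=j$, $F_C(k+1,j)=k+1$; if $\alpha_{j,k+1}\in C$, $-\alpha_{j,k+1}\notin C$ then $F_C(j,k+1)=F_C(k+1,j)=k+1$; if $-\alpha_{j,k+1}\in C$, $\alpha_{j,k+1}\notin C$ then $F_C(j,k+1)=F_C(k+1,j)=j$; if $\pm\alpha_{j,k+1}\in C$ then $F_C(j,k+1)=k+1$, $F_C(k+1,j)=j$. It is quasitrivial: $F_C(a,b)\in\{a,b\}$. The associativity index of $F_C$ is the cardinality of $\{(a,b,c): F_C(F_C(a,b),c)\ne F_C(a,F_C(b,c))\}$, with $a,b,c\in\{1,\dots,n+1\}$. The index of $C$ is the cardinality of the set of unordered pairs of distinct roots $$\{\{\alpha,\beta\}:\alpha\ne\beta,\ \alpha,\beta\in C,\ \alpha+\beta\in\Phi\setminus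 C\}\cup\{\{\alpha,\beta\}:\alpha\neq\beta,\ \alpha,\beta\in\Phi\setminus C,\ \alpha+\beta\in C\}.$$ *)

theory Defs imports Complex_Main begin

definition rootA :: "(nat \<Rightarrow> 'v::real_vector) \<Rightarrow> nat \<Rightarrow> nat \<Rightarrow> 'v" where
  \<comment> \<open>The second index is shifted as in the source:
     for \<open>j \<le> k\<close>, \<open>rootA \<alpha> j (k + 1) = \<alpha> j + \<dots> + \<alpha> k\<close>.\<close>
  "rootA \<alpha> j m = (\<Sum>i\<in>{j..<m}. \<alpha> i)"

definition PhiA :: "(nat \<Rightarrow> 'v::real_vector) \<Rightarrow> nat \<Rightarrow> 'v set" where
  "PhiA \<alpha> n = {v. \<exists>i k. 1 \<le> i \<and> i \<le> k \<and> k \<le> n \<and>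
                    (v = (\<Sum>l=i..k. \<alpha> l) \<or> v = - (\<Sum>l=i..k. \<alpha> l))}"

definition FC :: "(nat \<Rightarrow> 'v::real_vector) \<Rightarrow> 'v set \<Rightarrow> nat \<Rightarrow> nat \<Rightarrow> nat" where
  \<comment> \<open>In the branch \<open>a < b\<close> the pair \<open>(j, k + 1)\<close> is \<open>(a, b)\<close>; in the branch \<open>b < a\<close> it is \<open>(b, a)\<close>.
     The final \<open>else\<close> of each branch is the case where both roots lie in \<open>C\<close>.\<close>
  "FC \<alpha> C a b =
    (if a = b then a
     else if a < b then
       (let r = rootA \<alpha> a b in
          if r \<notin> C \<and> - r \<notin> C then a
          else if r \<in> C \<and> - r \<notin> C then b
          else if - r \<in> C \<and> r \<notin> C then a
          else b)
     else
       (let r = rootA \<alpha> b a in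
          if r \<notin> C \<and> - r \<notin> C then a
          else if r \<in> C \<and> - r \<notin> C then a
          else if - r \<in> C \<and> r \<notin> C then b
          else b))"

definition associativity_index :: "'a set \<Rightarrow> ('a \<Rightarrow> 'a \<Rightarrow> 'a) \<Rightarrow> nat" where
  "associativity_index S f =
     card {(a, b, c). a \<in> S \<and> b \<in> S \<and> c \<in> S \<and> f (f a b) c \<noteq> f a (f b c)}"

definition root_index :: "'v::real_vector set \<Rightarrow> 'v set \<Rightarrow> nat" where
  "root_index \<Phi> C =
     card ({{\<beta>, \<gamma>} | \<beta> \<gamma>. \<beta> \<noteq> \<gamma> \<and> \<beta> \<in> C \<and> \<gamma> \<in> C \<and> \<beta> + \<gamma> \<in> \<Phi> - C} \<union>
           {{\<beta>, \<gamma>} | \<beta> \<gamma>. \<beta> \<noteq> \<gamma> \<and> \<beta> \<in> \<Phi> - C \<and> \<gamma> \<in> \<Phi> - C \<and> \<beta> + \<gamma> \<in> C})"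

end

theory Submission imports Defs begin

text \<open>
  Put \<open>s m = \<alpha> 1 + \<dots> + \<alpha> (m - 1)\<close>, so that the roots are the differences \<open>s b - s a\<close> with
  \<open>a \<noteq> b\<close>, and let \<open>P a b\<close> mean \<open>s b - s a \<in> C\<close>.  All cases in the definition of the operation then
  collapse to \<open>F a b = (if P a b then b else a)\<close>, and \<open>(a, b, c)\<close> is non-associative iff
  \<open>a, b, c\<close> are distinct and \<open>P a b = P b c \<noteq> P a c\<close>.  On the other hand two roots have a root as
  their sum iff they can be written \<open>s b - s a\<close> and \<open>s c - s b\<close> with \<open>a, b, c\<close> distinct, and
  the unordered pair determines the triple \<open>(a, b, c)\<close>.
\<close>

definition partial_sum :: "(nat \<Rightarrow> 'v::real_vector) \<Rightarrow> nat \<Rightarrow> 'v" where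
  "partial_sum \<alpha> m = (\<Sum>i\<in>{1..<m}. \<alpha> i)"

lemma rootA_eq_diff:
  assumes "1 \<le> a" "a \<le> b"
  shows "rootA \<alpha> a b = partial_sum \<alpha> b - partial_sum \<alpha> a"
  using sum.atLeastLessThan_concat[OF assms, of \<alpha>]
  by (simp add: rootA_def partial_sum_def algebra_simps)

text \<open>The shift \<open>k + 1\<close> turns a sum over \<open>i..k\<close> into a difference of
  partial sums, and the order of the two indices encodes the sign of the root.\<close>

lemma PhiA_eq_diffs:
  "PhiA \<alpha> n = {partial_sum \<alpha> b - partial_sum \<alpha> a | a b. a \<in> {1..n+1} \<and> b \<in> {1..n+1} \<and> a \<noteq> b}"
  (is "_ = ?R")
proof
  have sum_eq: "(\<Sum>l=i..k. \<alpha> l) = partial_sum \<alpha> (Suc k) - partial_sum \<alpha> i" if "1 \<le> i" "i \<le> k" for i k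
    using rootA_eq_diff[of i "Suc k" \<alpha>] that by (simp add: rootA_def atLeastLessThanSuc_atLeastAtMost)
  show "PhiA \<alpha> n \<subseteq> ?R"
  proof
    fix v assume "v \<in> PhiA \<alpha> n"
    then obtain i k where ik: "1 \<le> i" "i \<le> k" "k \<le> n"
      and v: "v = (\<Sum>l=i..k. \<alpha> l) \<or> v = - (\<Sum>l=i..k. \<alpha> l)"
      by (auto simp: PhiA_def)
    have "v = partial_sum \<alpha> (Suc k) - partial_sum \<alpha> i \<or> v = partial_sum \<alpha> i - partial_sum \<alpha> (Suc k)"
      using v sum_eq[OF ik(1,2)] by auto
    moreover have "i \<in> {1..n+1}" "Suc k \<in> {1..n+1}" "i \<noteq> Suc k"
      using ik by auto
    ultimately show "v \<in> ?R"
      by blast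
  qed
  show "?R \<subseteq> PhiA \<alpha> n"
  proof
    fix v assume "v \<in> ?R"
    then obtain a b where ab: "a \<in> {1..n+1}" "b \<in> {1..n+1}" "a \<noteq> b"
      and v: "v = partial_sum \<alpha> b - partial_sum \<alpha> a" by blast
    show "v \<in> PhiA \<alpha> n"
    proof (cases "a < b")
      case True
      with ab v sum_eq[of a "b - 1"] have "v = (\<Sum>l=a..b-1. \<alpha> l)" by auto
      with True ab show ?thesis
        unfolding PhiA_def by (intro CollectI exI[of _ a] exI[of _ "b - 1"]) auto
    next
      case False
      with ab v sum_eq[of b "a - 1"] have "v = - (\<Sum>l=b..a-1. \<alpha> l)" by auto
      with False ab show ?thesis
        unfolding PhiA_def by (intro CollectI exI[of _ b] exI[of _ "a - 1"]) auto
    qed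
  qed
qed

text \<open>Prescribing the increments \<open>w (i + 1) - w i\<close> on the independent vectors
  makes the values on partial sums telescope. Linear relations between partial sums can thus be
  tested against arbitrary real weights.\<close>

lemma functional_on_partial_sums:
  fixes \<alpha> :: "nat \<Rightarrow> 'v::real_vector" and w :: "nat \<Rightarrow> real"
  assumes inj: "inj_on \<alpha> {1..n}" and indep: "independent (\<alpha> ` {1..n})"
  obtains \<phi> :: "'v \<Rightarrow> real" where "linear \<phi>"
    and "\<And>m. m \<in> {1..n+1} \<Longrightarrow> \<phi> (partial_sum \<alpha> m) = w m - w 1"
proof -
  obtain \<phi> :: "'v \<Rightarrow> real" where lin: "linear \<phi>"
    and \<phi>: "\<forall>x\<in>\<alpha> ` {1..n}. \<phi> x =
      w (Suc (the_inv_into {1..n} \<alpha> x)) - w (the_inv_into {1..n} \<alpha> x)"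
    using linear_independent_extend[OF indep,
        of "\<lambda>x. w (Suc (the_inv_into {1..n} \<alpha> x)) - w (the_inv_into {1..n} \<alpha> x)"] by blast
  have "\<phi> (partial_sum \<alpha> m) = w m - w 1" if m: "m \<in> {1..n+1}" for m
  proof -
    have "\<phi> (partial_sum \<alpha> m) = (\<Sum>i\<in>{1..<m}. \<phi> (\<alpha> i))"
      by (simp add: partial_sum_def linear_sum[OF lin])
    also have "\<dots> = (\<Sum>i\<in>{1..<m}. w (Suc i) - w i)"
      using m by (intro sum.cong refl) (simp add: \<phi> the_inv_into_f_f[OF inj] del: One_nat_def)
    also have "\<dots> = w m - w 1"
      using m by (intro sum_Suc_diff') auto
    finally show ?thesis .
  qed
  with lin show thesis by (rule that)
qed

lemma partial_sum_diff_eqD: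
  fixes \<alpha> :: "nat \<Rightarrow> 'v::real_vector"
  assumes inj: "inj_on \<alpha> {1..n}" and indep: "independent (\<alpha> ` {1..n})"
    and S: "a \<in> {1..n+1}" "b \<in> {1..n+1}" "c \<in> {1..n+1}" "d \<in> {1..n+1}"
    and eq: "partial_sum \<alpha> b - partial_sum \<alpha> a = partial_sum \<alpha> d - partial_sum \<alpha> c"
    and "a \<noteq> b"
  shows "a = c \<and> b = d"
proof -
  \<comment> \<open>The offset \<open>w 1\<close> cancels in every difference.\<close>
  have w: "w b - w a = w d - w c" for w :: "nat \<Rightarrow> real"
  proof -
    obtain \<phi> :: "'v \<Rightarrow> real" where lin: "linear \<phi>"
      and \<phi>: "\<And>m. m \<in> {1..n+1} \<Longrightarrow> \<phi> (partial_sum \<alpha> m) = w m - w 1"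
      using functional_on_partial_sums[OF inj indep, of w] by blast
    from arg_cong[OF eq, of \<phi>] show ?thesis
      by (simp only: linear_diff[OF lin] \<phi> S)
  qed
  \<comment> \<open>As \<open>a \<noteq> b\<close>, the indicator of \<open>a\<close> gives -1 on
    the left, which forces \<open>c = a\<close>; the indicator of \<open>b\<close> gives 1, which
    forces \<open>d = b\<close>.\<close>
  from w[of "\<lambda>m. of_bool (m = a)"] w[of "\<lambda>m. of_bool (m = b)"] \<open>a \<noteq> b\<close> show ?thesis
    by (auto split: if_splits simp: of_bool_def)
qed

text \<open>This is the converse of telescoping: a sum of two roots can be a root only if one of
  them starts at the index where the other ends.\<close>

lemma partial_sum_diff_addD:
  fixes \<alpha> :: "nat \<Rightarrow> 'v::real_vector"
  assumes inj: "inj_on \<alpha> {1..n}" and indep: "independent (\<alpha> ` {1..n})"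
    and S: "a \<in> {1..n+1}" "b \<in> {1..n+1}" "c \<in> {1..n+1}" "d \<in> {1..n+1}" "e \<in> {1..n+1}" "f \<in> {1..n+1}"
    and eq: "(partial_sum \<alpha> b - partial_sum \<alpha> a) + (partial_sum \<alpha> d - partial_sum \<alpha> c) =
      partial_sum \<alpha> f - partial_sum \<alpha> e"
    and "a \<noteq> b" "c \<noteq> d"
  shows "b = c \<or> d = a"
proof (rule ccontr)
  assume "\<not> (b = c \<or> d = a)"
  have w: "w b - w a + (w d - w c) = w f - w e" for w :: "nat \<Rightarrow> real"
  proof -
    obtain \<phi> :: "'v \<Rightarrow> real" where lin: "linear \<phi>"
      and \<phi>: "\<And>m. m \<in> {1..n+1} \<Longrightarrow> \<phi> (partial_sum \<alpha> m) = w m - w 1"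
      using functional_on_partial_sums[OF inj indep, of w] by blast
    from arg_cong[OF eq, of \<phi>] show ?thesis
      by (simp only: linear_add[OF lin] linear_diff[OF lin] \<phi> S)
  qed
  \<comment> \<open>The positive parts at \<open>b\<close> and \<open>d\<close> cannot cancel, but the right side has only one, at \<open>f\<close>.\<close>
  from w[of "\<lambda>m. of_bool (m = b)"] w[of "\<lambda>m. of_bool (m = d)"]
    \<open>\<not> (b = c \<or> d = a)\<close> \<open>a \<noteq> b\<close> \<open>c \<noteq> d\<close> show False
    by (auto split: if_splits simp: of_bool_def)
qed

text \<open>The result is governed by the root pointing from \<open>a\<close> to \<open>b\<close>,
  which is \<open>r\<close> in the branch \<open>a < b\<close> and \<open>- r\<close> in the branch
  \<open>b < a\<close>.\<close>

lemma FC_eq_if: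
  assumes "0 \<notin> C" "1 \<le> a" "1 \<le> b"
  shows "FC \<alpha> C a b = (if partial_sum \<alpha> b - partial_sum \<alpha> a \<in> C then b else a)"
  using assms by (auto simp: FC_def Let_def rootA_eq_diff)

text \<open>For distinct entries, if \<open>P a b\<close> and \<open>P b c\<close> hold, the two
  sides are \<open>c\<close> and \<open>f a c\<close>; if both fail, they are \<open>f a c\<close>
  and \<open>a\<close>. In the mixed cases the sides agree, as they do when two entries
  coincide.\<close>

lemma selection_nonassociative_iff:
  assumes f: "\<And>a b. a \<in> S \<Longrightarrow> b \<in> S \<Longrightarrow> f a b = (if P a b then b else a)"
    and irrefl: "\<And>a. \<not> P a a" and S: "a \<in> S" "b \<in> S" "c \<in> S"
  shows "f (f a b) c \<noteq> f a (f b c) \<longleftrightarrow>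
    a \<noteq> b \<and> b \<noteq> c \<and> a \<noteq> c \<and> (P a b \<longleftrightarrow> P b c) \<and> (P a c \<longleftrightarrow> \<not> P a b)"
  using S irrefl by (auto simp: f)

theorem theorem5p1:
  fixes n :: nat and \<alpha> :: "nat \<Rightarrow> 'v::real_vector" and C :: "'v set"
  assumes "n \<ge> 1"
    and "inj_on \<alpha> {1..n}"
    and "independent (\<alpha> ` {1..n})"
    and "span (\<alpha> ` {1..n}) = UNIV"
    and "C \<subseteq> PhiA \<alpha> n"
  shows "root_index (PhiA \<alpha> n) C = associativity_index {1..n+1} (FC \<alpha> C)"
proof -
  define S where "S = {1..n+1}"
  define e where "e a b = partial_sum \<alpha> b - partial_sum \<alpha> a" for a b
  define T where "T = {(a, b, c). a \<in> S \<and> b \<in> S \<and> c \<in> S \<and> a \<noteq> b \<and> b \<noteq> c \<and> a \<noteq> c \<and>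
    (e a b \<in> C \<longleftrightarrow> e b c \<in> C) \<and> (e a c \<in> C \<longleftrightarrow> e a b \<notin> C)}"
  define pair where "pair = (\<lambda>(a, b, c). {e a b, e b c})"
  note indep = assms(2,3)
  have Phi: "PhiA \<alpha> n = {e a b | a b. a \<in> S \<and> b \<in> S \<and> a \<noteq> b}"
    unfolding PhiA_eq_diffs S_def e_def ..
  have e_inj: "a = c \<and> b = d"
    if "e a b = e c d" "a \<noteq> b" "a \<in> S" "b \<in> S" "c \<in> S" "d \<in> S" for a b c d
    using partial_sum_diff_eqD[OF indep, of a b c d] that unfolding S_def e_def by blast
  have e_self: "e a a = 0" for a
    by (simp add: e_def)
  have e_chain: "e a b + e b c = e a c" for a b c
    by (simp add: e_def)
  \<comment> \<open>If \<open>e a b = 0 = e a a\<close>, then \<open>e_inj\<close> yields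
    \<open>b = a\<close>.\<close>
  have "0 \<notin> PhiA \<alpha> n"
    unfolding Phi using e_inj e_self by (smt (verit, best) mem_Collect_eq)
  then have zero: "0 \<notin> C"
    using assms(5) by blast

  have "{(a, b, c). a \<in> S \<and> b \<in> S \<and> c \<in> S \<and> FC \<alpha> C (FC \<alpha> C a b) c \<noteq> FC \<alpha> C a (FC \<alpha> C b c)} = T"
  proof -
    have F: "FC \<alpha> C a b = (if e a b \<in> C then b else a)" if "a \<in> S" "b \<in> S" for a b
      using FC_eq_if[OF zero] that by (simp add: S_def e_def)
    have irrefl: "e a a \<notin> C" for a
      using zero e_self by simp
    show ?thesis
      unfolding T_def using selection_nonassociative_iff[of S "FC \<alpha> C" "\<lambda>a b. e a b \<in> C", OF F irrefl]
      by blast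
  qed
  then have assoc: "associativity_index {1..n+1} (FC \<alpha> C) = card T"
    by (simp only: associativity_index_def S_def[symmetric])

  have inj: "inj_on pair T"
  proof (rule inj_onI)
    fix t t' assume t: "t \<in> T" "t' \<in> T" and eq: "pair t = pair t'"
    obtain a b c a' b' c' where tt: "t = (a, b, c)" "t' = (a', b', c')"
      by (metis prod_cases3)
    have S: "a \<in> S" "b \<in> S" "c \<in> S" "a' \<in> S" "b' \<in> S" "c' \<in> S" and ne: "a \<noteq> b" "b \<noteq> c" "a \<noteq> c"
      using t by (auto simp: T_def tt)
    have "e a b = e a' b' \<and> e b c = e b' c' \<or> e a b = e b' c' \<and> e b c = e a' b'"
      using eq by (auto simp: pair_def tt doubleton_eq_iff)
    \<comment> \<open>The crossed match would give \<open>a = b'\<close> and \<open>c = b'\<close>,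
      contradicting \<open>a \<noteq> c\<close>.\<close>
    then show "t = t'"
      using e_inj S ne unfolding tt by metis
  qed

  \<comment> \<open>A single symmetric predicate covers both sets in
    \<open>root_index\<close>.\<close>
  define mixed where "mixed \<beta> \<gamma> \<longleftrightarrow> \<beta> \<in> C \<and> \<gamma> \<in> C \<and> \<beta> + \<gamma> \<in> PhiA \<alpha> n - C \<or>
    \<beta> \<in> PhiA \<alpha> n - C \<and> \<gamma> \<in> PhiA \<alpha> n - C \<and> \<beta> + \<gamma> \<in> C" for \<beta> \<gamma>
  have "{{\<beta>, \<gamma>} | \<beta> \<gamma>. \<beta> \<noteq> \<gamma> \<and> mixed \<beta> \<gamma>} = pair ` T"
  proof
    show "pair ` T \<subseteq> {{\<beta>, \<gamma>} | \<beta> \<gamma>. \<beta> \<noteq> \<gamma> \<and> mixed \<beta> \<gamma>}"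
    proof
      fix X assume "X \<in> pair ` T"
      then obtain a b c where t: "(a, b, c) \<in> T" and X: "X = {e a b, e b c}"
        by (auto simp: pair_def)
      have S: "a \<in> S" "b \<in> S" "c \<in> S" "a \<noteq> b" "b \<noteq> c" "a \<noteq> c"
        using t by (auto simp: T_def)
      then have "e a b \<in> PhiA \<alpha> n" "e b c \<in> PhiA \<alpha> n" "e a c \<in> PhiA \<alpha> n"
        unfolding Phi by blast+
      then have "mixed (e a b) (e b c)"
        using t by (auto simp: mixed_def T_def e_chain)
      moreover have "e a b \<noteq> e b c"
        using e_inj S by blast
      ultimately show "X \<in> {{\<beta>, \<gamma>} | \<beta> \<gamma>. \<beta> \<noteq> \<gamma> \<and> mixed \<beta> \<gamma>}"
        unfolding X by blast
    qed
    show "{{\<beta>, \<gamma>} | \<beta> \<gamma>. \<beta> \<noteq> \<gamma> \<and> mixed \<beta> \<gamma>} \<subseteq> pair ` T"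
    proof
      fix X assume "X \<in> {{\<beta>, \<gamma>} | \<beta> \<gamma>. \<beta> \<noteq> \<gamma> \<and> mixed \<beta> \<gamma>}"
      then obtain \<beta> \<gamma> where X: "X = {\<beta>, \<gamma>}" and m: "mixed \<beta> \<gamma>"
        by blast
      then have "\<beta> \<in> PhiA \<alpha> n" "\<gamma> \<in> PhiA \<alpha> n" and sum: "\<beta> + \<gamma> \<in> PhiA \<alpha> n"
        using assms(5) by (auto simp: mixed_def)
      then obtain a b c d where \<beta>: "\<beta> = e a b" "a \<in> S" "b \<in> S" "a \<noteq> b"
        and \<gamma>: "\<gamma> = e c d" "c \<in> S" "d \<in> S" "c \<noteq> d"
        unfolding Phi by blast
      have triple: "{e a b, e b c} \<in> pair ` T"
        if "mixed (e a b) (e b c)" and "e a b + e b c \<in> PhiA \<alpha> n"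
          and S: "a \<in> S" "b \<in> S" "c \<in> S" "a \<noteq> b" "b \<noteq> c" for a b c
      proof -
        \<comment> \<open>Otherwise the two roots would be opposite and their sum 0, which is not a
          root.\<close>
        have "a \<noteq> c"
          using that(2) \<open>0 \<notin> PhiA \<alpha> n\<close> e_self e_chain by metis
        then have "(a, b, c) \<in> T"
          using that by (auto simp: T_def mixed_def e_chain)
        then show ?thesis
          by (force simp: pair_def)
      qed
      obtain p q where "e a b + e c d = e p q" "p \<in> S" "q \<in> S"
        using sum unfolding Phi \<beta> \<gamma> by blast
      then have "b = c \<or> d = a"
        using partial_sum_diff_addD[OF indep, of a b c d p q] \<beta> \<gamma> unfolding S_def e_def by blast
      then show "X \<in> pair ` T"
      proof
        assume "b = c"
        then show ?thesis
          using triple[of a b d] m sum \<beta> \<gamma> unfolding X by simp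
      next
        \<comment> \<open>Here the roots chain in the other order, \<open>\<gamma>\<close> before
          \<open>\<beta>\<close>, so the symmetry of \<open>mixed\<close> is used.\<close>
        assume "d = a"
        moreover have "mixed \<gamma> \<beta>"
          using m by (auto simp: mixed_def add.commute)
        ultimately show ?thesis
          using triple[of c d b] sum \<beta> \<gamma> unfolding X by (simp add: add.commute insert_commute)
      qed
    qed
  qed
  moreover have "root_index (PhiA \<alpha> n) C = card {{\<beta>, \<gamma>} | \<beta> \<gamma>. \<beta> \<noteq> \<gamma> \<and> mixed \<beta> \<gamma>}"
    unfolding root_index_def mixed_def by (rule arg_cong[of _ _ card]) blast
  ultimately show ?thesis
    using card_image[OF inj] assoc by simp
qed

end
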